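(* Suppose $M\ge2$ and $m=1$. Then there exist a valuation vector (with entries in $[0,1]$ and maximum demand $M$) and competing bids $[\boldsymbol\beta_-^t]_{t\in[T]}$ such that, under any learning algorithm, $\mathbb E[\mathsf{REG}]=\Omega(M\sqrt T)$ in the full information setting. Hence the same lower bound also holds under bandit feedback.
   Context: A uniform price auction selling $K$ identical units is repeated over $T$ rounds. A bidder has a fixed valuation $1\ge v_1\ge\dots\ge v_M\ge 0$, $w_j=\frac1j\sum_{\ell\le j}v_\ell$. A $1$-uniform strategy $(b,q)$ bids $b$ for each of $q$ units. Given competing bids $\boldsymbol\beta_-$ the $K$ highest bids win one unit each (ties in favor of the bidder), $x$ is the number of winning bids of the bidder, $V(\mathbf b;\boldsymbol\beta_-)=\sum_{j\le x}v_j$. $\overline{\mathcal P}_{\le 1}=\{(w_q,q):q\in[M]\}$. The competing bids $\boldsymbol\beta_-^t$ do not depend on the learner's actions; in round $t$ the learner picks (possibly randomly) $\mathbf b^t\in\overline{\mathcal P}_{\le1}$; under full information it observes $\boldsymbol\beta_-^t$ after the round, under bandit feedback only its own allocation and payment. $\mathsf{REG}=\max_{\mathbf b\in\overline{\mathcal P}_{\le 1}}\sum_{t}V(\mathbf b;\boldsymbol\beta_-^t)-\sum_t\mathbb E[V(\mathbf b^t;\boldsymbol\beta_-^t)]$; the expectation $\mathbb E[\mathsf{REG}]$ may additionally be over randomness of the competing bids.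
   Formalization: The maximum demand is assumed not to exceed the supply (M ≤ K); without this the bound fails, e.g. for K = 1, M = 2, where always playing (w_1,1) has no positive regret. *)

theory Defs
  imports "HOL-Probability.Probability_Mass_Function"
begin

text \<open>A strategy \<open>(b, q)\<close> bids \<open>b\<close> for each of \<open>q\<close> units. Valuations are indexed from 1, so
  \<open>v j\<close> is the marginal value of the \<open>j\<close>-th unit; values outside \<open>{1..M}\<close> are irrelevant.\<close>

type_synonym strategy = "real \<times> nat"
type_synonym competing_bids = "real list"

definition valuation :: "nat \<Rightarrow> (nat \<Rightarrow> real) \<Rightarrow> bool" where
  "valuation M v \<longleftrightarrow>
     (\<forall>j\<in>{1..M}. 0 \<le> v j \<and> v j \<le> 1) \<and>
     (\<forall>i\<in>{1..M}. \<forall>j\<in>{1..M}. i \<le> j \<longrightarrow> v j \<le> v i)"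

definition avg_value :: "(nat \<Rightarrow> real) \<Rightarrow> nat \<Rightarrow> real" where
  "avg_value v j = (\<Sum>l=1..j. v l) / real j"

definition uniform_strategies :: "nat \<Rightarrow> (nat \<Rightarrow> real) \<Rightarrow> strategy set" where
  "uniform_strategies M v = (\<lambda>q. (avg_value v q, q)) ` {1..M}"

definition bid_vector :: "strategy \<Rightarrow> real list" where
  "bid_vector s = replicate (snd s) (fst s)"

text \<open>The \<open>K\<close> highest bids, each tagged with whether it belongs to the bidder. \<^const>\<open>sort_key\<close> is
  stable and the bidder's bids come first, so ties are broken in favor of the bidder.\<close>

definition winning_bids :: "nat \<Rightarrow> real list \<Rightarrow> competing_bids \<Rightarrow> (real \<times> bool) list" where
  "winning_bids K bs \<beta> =
     take K (sort_key (\<lambda>x. - fst x) (map (\<lambda>b. (b, True)) bs @ map (\<lambda>b. (b, False)) \<beta>))"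

definition allocation :: "nat \<Rightarrow> strategy \<Rightarrow> competing_bids \<Rightarrow> nat" where
  "allocation K s \<beta> = length (filter snd (winning_bids K (bid_vector s) \<beta>))"

text \<open>The uniform price is the lowest winning (i.e. the \<open>K\<close>-th highest) bid.\<close>

definition clearing_price :: "nat \<Rightarrow> strategy \<Rightarrow> competing_bids \<Rightarrow> real" where
  "clearing_price K s \<beta> = fst (last (winning_bids K (bid_vector s) \<beta>))"

definition payment :: "nat \<Rightarrow> strategy \<Rightarrow> competing_bids \<Rightarrow> real" where
  "payment K s \<beta> = real (allocation K s \<beta>) * clearing_price K s \<beta>"

definition obtained_value :: "nat \<Rightarrow> (nat \<Rightarrow> real) \<Rightarrow> strategy \<Rightarrow> competing_bids \<Rightarrow> real" where
  "obtained_value K v s \<beta> = (\<Sum>j=1..allocation K s \<beta>. v j)"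

text \<open>A learning algorithm maps the history of its own strategies and the feedback received, oldest
  round first, to the distribution of its next strategy.\<close>

type_synonym 'o learner = "(strategy \<times> 'o) list \<Rightarrow> strategy pmf"

definition full_information :: "strategy \<Rightarrow> competing_bids \<Rightarrow> competing_bids" where
  "full_information s \<beta> = \<beta>"

definition bandit :: "nat \<Rightarrow> strategy \<Rightarrow> competing_bids \<Rightarrow> nat \<times> real" where
  "bandit K s \<beta> = (allocation K s \<beta>, payment K s \<beta>)"

definition learner_on :: "strategy set \<Rightarrow> 'o learner \<Rightarrow> bool" where
  "learner_on S A \<longleftrightarrow> (\<forall>h. set_pmf (A h) \<subseteq> S)"

text \<open>Joint distribution of the strategies chosen against the fixed sequence of competing bids in
  the last argument, when the history so far is \<open>h\<close>.\<close>

primrec play ::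
  "(strategy \<Rightarrow> competing_bids \<Rightarrow> 'o) \<Rightarrow> 'o learner \<Rightarrow> (strategy \<times> 'o) list \<Rightarrow>
     competing_bids list \<Rightarrow> strategy list pmf" where
  "play fb A h [] = return_pmf []"
| "play fb A h (\<beta> # \<beta>s) =
     bind_pmf (A h) (\<lambda>s. map_pmf ((#) s) (play fb A (h @ [(s, fb s \<beta>)]) \<beta>s))"

definition regret ::
  "nat \<Rightarrow> nat \<Rightarrow> (nat \<Rightarrow> real) \<Rightarrow> (strategy \<Rightarrow> competing_bids \<Rightarrow> 'o) \<Rightarrow> 'o learner \<Rightarrow>
     competing_bids list \<Rightarrow> real" where
  "regret M K v fb A \<beta>s =
     Max ((\<lambda>s. \<Sum>t<length \<beta>s. obtained_value K v s (\<beta>s ! t)) ` uniform_strategies M v) -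
     (\<Sum>t<length \<beta>s.
        measure_pmf.expectation (play fb A [] \<beta>s) (\<lambda>ss. obtained_value K v (ss ! t) (\<beta>s ! t)))"

text \<open>The law \<open>D\<close> of the sequence of competing bids does not depend on the learner's actions.\<close>

definition expected_regret ::
  "nat \<Rightarrow> nat \<Rightarrow> (nat \<Rightarrow> real) \<Rightarrow> (strategy \<Rightarrow> competing_bids \<Rightarrow> 'o) \<Rightarrow> 'o learner \<Rightarrow>
     competing_bids list pmf \<Rightarrow> real" where
  "expected_regret M K v fb A D = measure_pmf.expectation D (regret M K v fb A)"

definition competing_law :: "nat \<Rightarrow> nat \<Rightarrow> competing_bids list pmf \<Rightarrow> bool" where
  "competing_law K T D \<longleftrightarrow>
     (\<forall>\<beta>s\<in>set_pmf D. length \<beta>s = T \<and> (\<forall>\<beta>\<in>set \<beta>s. length \<beta> = K \<and> set \<beta> \<subseteq> {0..1}))"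

end

theory Submission
  imports Defs
begin

text \<open>Let \<open>h = M div 2\<close>, let the first \<open>h\<close> units be worth 1 and the others \<open>h / (2 (M - h))\<close>, so that
  all \<open>M\<close> units are worth \<open>3h/2\<close>. Independently in each round, the competing bids are all 0 with
  probability 2/3 and all 1 with probability 1/3. At competing bids 1 a strategy \<open>q \<le> h\<close> still wins
  its \<open>q\<close> units by the tie-breaking rule, while a strategy \<open>q > h\<close> bids below 1 and wins nothing.
  Hence no strategy has expected value above \<open>h\<close> per round, and no learner collects more than \<open>h T\<close>.
  In hindsight, \<open>q = h\<close> collects exactly \<open>h T\<close>, and \<open>q = M\<close> collects \<open>h T + (h/2) S\<close>
  for a centred random walk \<open>S\<close> of length \<open>T\<close>. The better of the two exceeds \<open>h T\<close> by
  \<open>(h/4) E \<bar>S\<bar>\<close> in expectation, and \<open>E \<bar>S\<bar>\<close> is of order \<open>sqrt T\<close> by comparing second and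
  fourth moments.\<close>

section \<open>Finitely supported distributions\<close>

lemma expectation_bind_finite:
  fixes f :: "'b \<Rightarrow> real"
  assumes "finite (set_pmf p)" "\<And>x. x \<in> set_pmf p \<Longrightarrow> finite (set_pmf (g x))"
  shows "measure_pmf.expectation (bind_pmf p g) f =
           measure_pmf.expectation p (\<lambda>x. measure_pmf.expectation (g x) f)"
  using assms
  by (subst pmf_expectation_bind[of "set_pmf p"])
     (auto simp: integral_measure_pmf[of "set_pmf p"])

lemma expectation_swap_finite:
  fixes f :: "'a \<Rightarrow> 'b \<Rightarrow> real"
  assumes "finite (set_pmf p)" "finite (set_pmf q)"
  shows "measure_pmf.expectation p (\<lambda>x. measure_pmf.expectation q (f x)) =
           measure_pmf.expectation q (\<lambda>y. measure_pmf.expectation p (\<lambda>x. f x y))"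
proof -
  have "measure_pmf.expectation p (\<lambda>x. measure_pmf.expectation q (f x)) =
      (\<Sum>x\<in>set_pmf p. \<Sum>y\<in>set_pmf q. pmf p x * (pmf q y * f x y))"
    using assms by (simp add: integral_measure_pmf[of "set_pmf p"]
        integral_measure_pmf[of "set_pmf q"] sum_distrib_left)
  also have "\<dots> = (\<Sum>y\<in>set_pmf q. \<Sum>x\<in>set_pmf p. pmf p x * (pmf q y * f x y))"
    by (rule sum.swap)
  also have "\<dots> = measure_pmf.expectation q (\<lambda>y. measure_pmf.expectation p (\<lambda>x. f x y))"
    using assms by (simp add: integral_measure_pmf[of "set_pmf p"]
        integral_measure_pmf[of "set_pmf q"] sum_distrib_left mult.left_commute)
  finally show ?thesis .
qed

lemma expectation_mono_finite:
  fixes f g :: "'a \<Rightarrow> real"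
  assumes "finite (set_pmf p)" "\<And>x. x \<in> set_pmf p \<Longrightarrow> f x \<le> g x"
  shows "measure_pmf.expectation p f \<le> measure_pmf.expectation p g"
  using assms
  by (intro integral_mono_AE integrable_measure_pmf_finite) (auto simp: AE_measure_pmf_iff)

lemma finite_set_replicate_pmf:
  assumes "finite (set_pmf p)"
  shows "finite (set_pmf (replicate_pmf n p))"
  using finite_lists_length_eq[OF assms, of n]
  by (simp add: set_replicate_pmf lists_eq_set)

lemma expectation_replicate_pmf_Suc:
  fixes f :: "'a list \<Rightarrow> real"
  assumes "finite (set_pmf p)"
  shows "measure_pmf.expectation (replicate_pmf (Suc n) p) f =
           measure_pmf.expectation p
             (\<lambda>x. measure_pmf.expectation (replicate_pmf n p) (\<lambda>xs. f (x # xs)))"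
  using assms
  by (simp add: expectation_bind_finite finite_set_replicate_pmf flip: map_pmf_def)

section \<open>Centred random walks\<close>

text \<open>Splitting off the first step and expanding the power, independence kills every mixed
  term containing a first power of the step or of the remaining walk. In the fourth moment the
  surviving mixed term has coefficient 6, and summing \<open>6 * k\<close> over \<open>k < n\<close>
  gives \<open>3 * n * (n - 1)\<close>.\<close>

lemma random_walk_moments:
  fixes g :: "'a \<Rightarrow> real"
  assumes fin: "finite (set_pmf p)"
    and mean: "measure_pmf.expectation p g = 0"
  shows random_walk_mean:
      "measure_pmf.expectation (replicate_pmf n p) (\<lambda>xs. \<Sum>x\<leftarrow>xs. g x) = 0"
    and random_walk_second_moment:
      "measure_pmf.expectation (replicate_pmf n p) (\<lambda>xs. (\<Sum>x\<leftarrow>xs. g x) ^ 2) =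
         real n * measure_pmf.expectation p (\<lambda>x. g x ^ 2)"
    and random_walk_fourth_moment:
      "measure_pmf.expectation (replicate_pmf n p) (\<lambda>xs. (\<Sum>x\<leftarrow>xs. g x) ^ 4) =
         real n * measure_pmf.expectation p (\<lambda>x. g x ^ 4) +
         3 * real n * (real n - 1) * (measure_pmf.expectation p (\<lambda>x. g x ^ 2)) ^ 2"
proof -
  note [simp] = integrable_measure_pmf_finite[OF fin]
    integrable_measure_pmf_finite[OF finite_set_replicate_pmf[OF fin]]
  show m1: "measure_pmf.expectation (replicate_pmf n p) (\<lambda>xs. \<Sum>x\<leftarrow>xs. g x) = 0" for n
    by (induction n) (simp_all add: expectation_replicate_pmf_Suc[OF fin] mean
        del: replicate_pmf.simps(2))
  show m2: "measure_pmf.expectation (replicate_pmf n p) (\<lambda>xs. (\<Sum>x\<leftarrow>xs. g x) ^ 2) =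
         real n * measure_pmf.expectation p (\<lambda>x. g x ^ 2)" for n
    by (induction n) (simp_all add: expectation_replicate_pmf_Suc[OF fin] m1 mean power2_sum
        algebra_simps del: replicate_pmf.simps(2))
  have pow4: "(a + b) ^ 4 = a ^ 4 + 4 * (a ^ 3 * b) + 6 * (a ^ 2 * b ^ 2) + 4 * (a * b ^ 3) + b ^ 4"
    for a b :: real
    by algebra
  show "measure_pmf.expectation (replicate_pmf n p) (\<lambda>xs. (\<Sum>x\<leftarrow>xs. g x) ^ 4) =
         real n * measure_pmf.expectation p (\<lambda>x. g x ^ 4) +
         3 * real n * (real n - 1) * (measure_pmf.expectation p (\<lambda>x. g x ^ 2)) ^ 2" for n
  proof (induction n)
    case (Suc n)
    show ?case
      by (simp add: expectation_replicate_pmf_Suc[OF fin] m1 m2 mean pow4 Suc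
          del: replicate_pmf.simps(2)) (simp add: algebra_simps power2_eq_square)
  qed simp
qed

text \<open>A polynomial minorant of the absolute value turns second and fourth moments into a lower
  bound on a first absolute moment. With \<open>\<bar>x\<bar> = L * u\<close> the claim becomes
  \<open>u * (4 - 4 * u + u ^ 3) \<ge> 0\<close>.\<close>

lemma abs_ge_square_minus_fourth:
  fixes x L :: real
  assumes "L > 0"
  shows "x ^ 2 / L - x ^ 4 / (4 * L ^ 3) \<le> \<bar>x\<bar>"
proof -
  define u where "u = \<bar>x\<bar> / L"
  have u: "u \<ge> 0" and x: "\<bar>x\<bar> = L * u"
    using assms by (simp_all add: u_def)
  have "4 - 4 * u + u ^ 3 \<ge> 0"
  proof (cases "u \<le> 2")
    case True
    have "4 - 4 * u + u ^ 3 = (u + 2) * (u - 1) ^ 2 + (2 - u)"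
      by algebra
    also have "\<dots> \<ge> 0"
      using u True by (intro add_nonneg_nonneg mult_nonneg_nonneg) auto
    finally show ?thesis .
  next
    case False
    have "4 - 4 * u + u ^ 3 = u * (u - 2) * (u + 2) + 4"
      by algebra
    also have "\<dots> \<ge> 0"
      using False by (intro add_nonneg_nonneg mult_nonneg_nonneg) auto
    finally show ?thesis .
  qed
  hence "0 \<le> L * u * (4 - 4 * u + u ^ 3)"
    using u assms by simp
  moreover have "x ^ 2 = (L * u) ^ 2" "x ^ 4 = (L * u) ^ 4"
    unfolding x[symmetric] by (simp_all add: power_even_abs)
  ultimately show ?thesis
    using assms unfolding x
    by (simp add: power2_eq_square power3_eq_cube power4_eq_xxxx field_simps)
qed

section \<open>The learner against independent competing bids\<close>

lemma finite_set_play: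
  assumes "finite S" "learner_on S A"
  shows "finite (set_pmf (play fb A h \<beta>s))"
  using assms finite_subset[OF _ assms(1)]
  by (induction \<beta>s arbitrary: h) (auto simp: learner_on_def)

text \<open>The starting history \<open>h\<close> is a parameter so that induction over the rounds
  can extend it.\<close>

definition play_value ::
  "(strategy \<Rightarrow> competing_bids \<Rightarrow> real) \<Rightarrow> (strategy \<Rightarrow> competing_bids \<Rightarrow> 'o) \<Rightarrow>
     'o learner \<Rightarrow> (strategy \<times> 'o) list \<Rightarrow> competing_bids list \<Rightarrow> real" where
  "play_value V fb A h \<beta>s =
     (\<Sum>t<length \<beta>s. measure_pmf.expectation (play fb A h \<beta>s) (\<lambda>ss. V (ss ! t) (\<beta>s ! t)))"

lemma play_value_Cons:
  assumes "finite S" "learner_on S A"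
  shows "play_value V fb A h (\<beta> # \<beta>s) =
           measure_pmf.expectation (A h) (\<lambda>s. V s \<beta> + play_value V fb A (h @ [(s, fb s \<beta>)]) \<beta>s)"
proof -
  have fin: "finite (set_pmf (A h))"
    using assms finite_subset by (fastforce simp: learner_on_def)
  note [simp] = integrable_measure_pmf_finite[OF fin] finite_set_play[OF assms] fin
  have "play_value V fb A h (\<beta> # \<beta>s) =
      measure_pmf.expectation (A h) (\<lambda>s. V s \<beta>) +
      (\<Sum>t<length \<beta>s. measure_pmf.expectation (A h) (\<lambda>s.
         measure_pmf.expectation (play fb A (h @ [(s, fb s \<beta>)]) \<beta>s) (\<lambda>ss. V (ss ! t) (\<beta>s ! t))))"
    unfolding play_value_def
    by (simp add: sum.lessThan_Suc_shift expectation_bind_finite del: sum.lessThan_Suc)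
  thus ?thesis
    by (simp add: play_value_def)
qed

text \<open>The strategy of a round is drawn before the independent bids of that round, so whatever
  the history, it earns at most \<open>\<mu>\<close> on average. The feedback \<open>fb\<close> is
  arbitrary, which covers full information and bandit feedback at once.\<close>

lemma expectation_play_value_le:
  assumes S: "finite S" "learner_on S A"
    and p: "finite (set_pmf p)"
    and V: "\<And>s. s \<in> S \<Longrightarrow> measure_pmf.expectation p (V s) \<le> \<mu>"
  shows "measure_pmf.expectation (replicate_pmf n p) (play_value V fb A h) \<le> real n * \<mu>"
proof (induction n arbitrary: h)
  case 0
  show ?case by (simp add: play_value_def)
next
  case (Suc n)
  have fin: "finite (set_pmf (A h))" for h
    using S finite_subset by (fastforce simp: learner_on_def)
  note finR = finite_set_replicate_pmf[OF p]
  note [simp] = integrable_measure_pmf_finite[OF fin] integrable_measure_pmf_finite[OF p]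
    integrable_measure_pmf_finite[OF finR]
  let ?W = "\<lambda>s \<beta>. measure_pmf.expectation (replicate_pmf n p) (play_value V fb A (h @ [(s, fb s \<beta>)]))"
  \<comment> \<open>Two swaps make the learner's draw of \<open>s\<close> the outermost expectation:
    first past the future rounds, then past the current bids. For fixed \<open>s\<close>, the bound
    on \<open>V\<close> and the induction hypothesis then apply.\<close>
  have "measure_pmf.expectation (replicate_pmf (Suc n) p) (play_value V fb A h) =
      measure_pmf.expectation p (\<lambda>\<beta>. measure_pmf.expectation (A h) (\<lambda>s. V s \<beta> + ?W s \<beta>))"
    by (simp add: expectation_replicate_pmf_Suc[OF p] play_value_Cons[OF S]
        expectation_swap_finite[OF finR fin] del: replicate_pmf.simps)
  also have "\<dots> = measure_pmf.expectation (A h) (\<lambda>s. measure_pmf.expectation p (\<lambda>\<beta>. V s \<beta> + ?W s \<beta>))"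
    by (rule expectation_swap_finite[OF p fin])
  also have "\<dots> \<le> measure_pmf.expectation (A h) (\<lambda>s. \<mu> + real n * \<mu>)"
  proof (rule expectation_mono_finite[OF fin])
    fix s assume "s \<in> set_pmf (A h)"
    hence "s \<in> S" using S by (auto simp: learner_on_def)
    moreover have "measure_pmf.expectation p (?W s) \<le> measure_pmf.expectation p (\<lambda>_. real n * \<mu>)"
      by (intro expectation_mono_finite[OF p] Suc)
    ultimately show "measure_pmf.expectation p (\<lambda>\<beta>. V s \<beta> + ?W s \<beta>) \<le> \<mu> + real n * \<mu>"
      using V by (fastforce intro: add_mono)
  qed
  finally show ?case
    by (simp add: algebra_simps)
qed

section \<open>The hard instance\<close>

text \<open>If \<open>x \<le> b\<close>, the list is already sorted, ties included, and the bidder's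
  \<open>q\<close> bids come first. Otherwise the \<open>K\<close> competing bids move to the front
  and take every unit.\<close>

lemma allocation_replicate:
  assumes "q \<le> K"
  shows "allocation K (b, q) (replicate K x) = (if x \<le> b then q else 0)"
proof -
  let ?us = "replicate q (b, True)" and ?cs = "replicate K (x, False)"
  show ?thesis
  proof (cases "x \<le> b")
    case True
    have "sort_key (\<lambda>y. - fst y) (?us @ ?cs) = ?us @ ?cs"
      by (rule sort_key_id_if_sorted) (use True in \<open>auto simp: sorted_append\<close>)
    thus ?thesis
      using True assms by (simp add: allocation_def winning_bids_def bid_vector_def)
  next
    case False
    have "sort_key (\<lambda>y. - fst y) (?us @ ?cs) = ?cs @ ?us"
      by (rule properties_for_sort_key) (use False in \<open>auto simp: sorted_append\<close>)
    thus ?thesis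
      using False assms by (simp add: allocation_def winning_bids_def bid_vector_def)
  qed
qed

definition step_valuation :: "nat \<Rightarrow> nat \<Rightarrow> nat \<Rightarrow> real" where
  "step_valuation M h j = (if j \<le> h then 1 else real h / (2 * real (M - h)))"

text \<open>The probability \<open>2/3\<close> of zero bids balances the two strategies: bidding for
  all \<open>M\<close> units earns \<open>2/3 * (3 * h / 2) = h\<close> on average, the same as
  bidding for \<open>h\<close> units.\<close>

definition zero_or_one_bids :: "nat \<Rightarrow> competing_bids pmf" where
  "zero_or_one_bids K = map_pmf (\<lambda>b. replicate K (if b then 0 else 1)) (bernoulli_pmf (2/3))"

lemma set_zero_or_one_bids:
  "set_pmf (zero_or_one_bids K) = {replicate K 0, replicate K 1}"
  by (auto simp: zero_or_one_bids_def set_pmf_bernoulli UNIV_bool)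

lemma expectation_zero_or_one_bids:
  fixes f :: "competing_bids \<Rightarrow> real"
  shows "measure_pmf.expectation (zero_or_one_bids K) f =
           2/3 * f (replicate K 0) + 1/3 * f (replicate K 1)"
  by (simp add: zero_or_one_bids_def)

section \<open>Values of the strategies on the instance\<close>

context
  fixes M h K :: nat
  assumes h: "0 < h" "2 * h \<le> M" and MK: "M \<le> K"
begin

abbreviation "val \<equiv> step_valuation M h"

text \<open>Since \<open>M - h \<ge> h\<close>, the value of the later units is at most 1/2.\<close>

lemma step_valuation_bounds: "0 \<le> val j" "val j \<le> 1" "h < j \<Longrightarrow> val j < 1"
  using h by (auto simp: step_valuation_def field_simps)

lemma valuation_step: "valuation M val"
  unfolding valuation_def
  using step_valuation_bounds by (auto simp: step_valuation_def)

lemma sum_step_valuation_low: "q \<le> h \<Longrightarrow> (\<Sum>l=1..q. val l) = real q"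
  by (simp add: step_valuation_def)

lemma sum_step_valuation_all: "(\<Sum>l=1..M. val l) = 3 * real h / 2"
proof -
  have "{1..M} = {1..h} \<union> {h+1..M}" using h by auto
  hence "(\<Sum>l=1..M. val l) = (\<Sum>l=1..h. val l) + (\<Sum>l=h+1..M. val l)"
    by (simp add: sum.union_disjoint)
  also have "(\<Sum>l=h+1..M. val l) = (\<Sum>l=h+1..M. real h / (2 * real (M - h)))"
    by (rule sum.cong) (auto simp: step_valuation_def)
  also have "\<dots> = real h / 2"
    using h by (simp add: field_simps)
  finally show ?thesis
    by (simp add: sum_step_valuation_low del: One_nat_def)
qed

lemma avg_step_valuation_low: "0 < q \<Longrightarrow> q \<le> h \<Longrightarrow> avg_value val q = 1"
  by (simp add: avg_value_def sum_step_valuation_low del: One_nat_def)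

lemma avg_step_valuation_nonneg: "0 \<le> avg_value val q"
  by (simp add: avg_value_def sum_nonneg step_valuation_bounds)

lemma avg_step_valuation_high:
  assumes "h < q"
  shows "avg_value val q < 1"
proof -
  have "(\<Sum>l=1..q. val l) < (\<Sum>l=1..q. 1)"
    by (rule sum_strict_mono_ex1) (use assms step_valuation_bounds in \<open>auto intro: bexI[of _ q]\<close>)
  thus ?thesis
    using assms by (simp add: avg_value_def)
qed

lemma obtained_value_zero_bids:
  assumes "q \<le> M"
  shows "obtained_value K val (avg_value val q, q) (replicate K 0) = (\<Sum>l=1..q. val l)"
  using assms MK by (simp add: obtained_value_def allocation_replicate avg_step_valuation_nonneg)

lemma obtained_value_one_bids:
  assumes "0 < q" "q \<le> M"
  shows "obtained_value K val (avg_value val q, q) (replicate K 1) = (if q \<le> h then real q else 0)"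
  using assms MK avg_step_valuation_high[of q]
  by (auto simp: obtained_value_def allocation_replicate avg_step_valuation_low
      sum_step_valuation_low simp del: One_nat_def)

text \<open>For \<open>q \<le> h\<close> the value is \<open>q\<close> under both outcomes. For
  \<open>q > h\<close> only zero bids pay, and they pay at most the total \<open>3 * h / 2\<close>,
  with probability \<open>2/3\<close>.\<close>

lemma expected_obtained_value_le:
  assumes "s \<in> uniform_strategies M val"
  shows "measure_pmf.expectation (zero_or_one_bids K) (obtained_value K val s) \<le> real h"
proof -
  obtain q where q: "s = (avg_value val q, q)" "0 < q" "q \<le> M"
    using assms by (auto simp: uniform_strategies_def)
  have "(\<Sum>l=1..q. val l) \<le> (\<Sum>l=1..M. val l)"
    by (rule sum_mono2) (use q step_valuation_bounds in auto)
  thus ?thesis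
    using q sum_step_valuation_low[of q] sum_step_valuation_all
    by (cases "q \<le> h")
       (simp_all add: expectation_zero_or_one_bids obtained_value_zero_bids
         obtained_value_one_bids del: One_nat_def)
qed

section \<open>Surplus walk and gain in hindsight\<close>

text \<open>The surplus of bidding for all \<open>M\<close> units over bidding for \<open>h\<close>, in units of \<open>h/2\<close>.\<close>

definition surplus :: "competing_bids \<Rightarrow> real" where
  "surplus \<beta> = (if \<beta> = replicate K 0 then 1 else -2)"

lemma K_pos: "0 < K"
  using h MK by linarith

text \<open>Ensures that \<open>surplus\<close> takes the value -2 at the all-one bids; for
  \<open>K = 0\<close> both outcomes would be the empty list.\<close>

lemma replicate_one_neq_zero: "replicate K (1::real) \<noteq> replicate K 0"
  using K_pos by (simp add: replicate_eq_replicate)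

lemma obtained_value_h:
  assumes "\<beta> \<in> set_pmf (zero_or_one_bids K)"
  shows "obtained_value K val (avg_value val h, h) \<beta> = real h"
  using assms h
  by (auto simp: set_zero_or_one_bids obtained_value_zero_bids obtained_value_one_bids
      sum_step_valuation_low simp del: One_nat_def)

lemma obtained_value_M:
  assumes "\<beta> \<in> set_pmf (zero_or_one_bids K)"
  shows "obtained_value K val (avg_value val M, M) \<beta> = real h + real h / 2 * surplus \<beta>"
  using assms h replicate_one_neq_zero sum_step_valuation_all
  by (auto simp: set_zero_or_one_bids obtained_value_zero_bids obtained_value_one_bids
      surplus_def simp del: One_nat_def)

text \<open>The minorant is applied with \<open>L = 2 * sqrt T\<close>. Second moment
  \<open>2 * T\<close> and fourth moment at most \<open>12 * T ^ 2\<close> give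
  \<open>(1 - 3/8) * sqrt T\<close>.\<close>

lemma expected_abs_surplus:
  assumes "0 < T"
  shows "5/8 * sqrt (real T) \<le>
    measure_pmf.expectation (replicate_pmf T (zero_or_one_bids K)) (\<lambda>\<beta>s. \<bar>\<Sum>\<beta>\<leftarrow>\<beta>s. surplus \<beta>\<bar>)"
proof -
  let ?p = "zero_or_one_bids K" and ?S = "\<lambda>\<beta>s. \<Sum>\<beta>\<leftarrow>\<beta>s. surplus \<beta>"
  let ?E = "measure_pmf.expectation (replicate_pmf T ?p)"
  have fin: "finite (set_pmf ?p)" by (simp add: set_zero_or_one_bids)
  note finR = finite_set_replicate_pmf[OF fin, of T]
  note [simp] = integrable_measure_pmf_finite[OF finR]
  define r where "r = sqrt (real T)"
  have r: "0 < r" "real T = r ^ 2" using assms by (simp_all add: r_def)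
  have mean: "measure_pmf.expectation ?p surplus = 0"
    and moments: "measure_pmf.expectation ?p (\<lambda>\<beta>. surplus \<beta> ^ 2) = 2"
      "measure_pmf.expectation ?p (\<lambda>\<beta>. surplus \<beta> ^ 4) = 6"
    using replicate_one_neq_zero by (simp_all add: expectation_zero_or_one_bids surplus_def)
  have m2: "?E (\<lambda>\<beta>s. ?S \<beta>s ^ 2) = 2 * r ^ 2"
    using random_walk_second_moment[OF fin mean] by (simp add: moments r)
  have m4: "?E (\<lambda>\<beta>s. ?S \<beta>s ^ 4) \<le> 12 * r ^ 4"
  proof -
    have "?E (\<lambda>\<beta>s. ?S \<beta>s ^ 4) = 12 * real T * real T - 6 * real T"
      using random_walk_fourth_moment[OF fin mean, of T] by (simp add: moments algebra_simps)
    thus ?thesis by (simp add: r(2) power2_eq_square power4_eq_xxxx)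
  qed
  have "5/8 * r = 2 * r ^ 2 / (2 * r) - 12 * r ^ 4 / (4 * (2 * r) ^ 3)"
    using r(1) by (simp add: field_simps power2_eq_square power3_eq_cube power4_eq_xxxx)
  also have "\<dots> \<le> ?E (\<lambda>\<beta>s. ?S \<beta>s ^ 2) / (2 * r) - ?E (\<lambda>\<beta>s. ?S \<beta>s ^ 4) / (4 * (2 * r) ^ 3)"
    unfolding m2 using r(1) m4 by (intro diff_mono divide_right_mono) auto
  also have "\<dots> = ?E (\<lambda>\<beta>s. ?S \<beta>s ^ 2 / (2 * r) - ?S \<beta>s ^ 4 / (4 * (2 * r) ^ 3))"
    by simp
  also have "\<dots> \<le> ?E (\<lambda>\<beta>s. \<bar>?S \<beta>s\<bar>)"
    by (intro expectation_mono_finite[OF finR] abs_ge_square_minus_fourth) (use r in simp)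
  finally show ?thesis by (simp add: r_def)
qed

text \<open>The maximum dominates the strategies for \<open>h\<close> and for \<open>M\<close>
  units, whose totals differ by \<open>h / 2\<close> times the walk; the positive part of the walk
  is half the sum of the walk and its absolute value.\<close>

lemma best_strategy_ge:
  assumes "\<beta>s \<in> set_pmf (replicate_pmf T (zero_or_one_bids K))"
  shows "real T * real h + real h / 4 * ((\<Sum>\<beta>\<leftarrow>\<beta>s. surplus \<beta>) + \<bar>\<Sum>\<beta>\<leftarrow>\<beta>s. surplus \<beta>\<bar>) \<le>
    Max ((\<lambda>s. \<Sum>t<length \<beta>s. obtained_value K val s (\<beta>s ! t)) ` uniform_strategies M val)"
    (is "?L \<le> Max (?f ` ?U)")
proof -
  have len: "length \<beta>s = T" and el: "\<And>t. t < T \<Longrightarrow> \<beta>s ! t \<in> set_pmf (zero_or_one_bids K)"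
    using assms by (auto simp: set_replicate_pmf)
  let ?S = "\<Sum>\<beta>\<leftarrow>\<beta>s. surplus \<beta>"
  have S: "?S = (\<Sum>t<T. surplus (\<beta>s ! t))"
    by (simp add: sum_list_sum_nth len atLeast0LessThan)
  have mem: "(avg_value val h, h) \<in> ?U" "(avg_value val M, M) \<in> ?U"
    using h by (auto simp: uniform_strategies_def)
  have "finite ?U" by (simp add: uniform_strategies_def)
  hence ge: "?f s \<le> Max (?f ` ?U)" if "s \<in> ?U" for s
    using that by simp
  have "?f (avg_value val h, h) = real T * real h"
    by (simp add: len el obtained_value_h)
  moreover have "?f (avg_value val M, M) = real T * real h + real h / 2 * ?S"
    by (simp add: S len el obtained_value_M sum.distrib sum_distrib_left sum_divide_distrib)
  moreover have "?L = (if 0 \<le> ?S then real T * real h + real h / 2 * ?S else real T * real h)"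
    by simp
  ultimately show ?thesis
    using ge[OF mem(1)] ge[OF mem(2)] by auto
qed

text \<open>The linear part of the hindsight gain has mean zero, leaving \<open>h / 4\<close> times
  the expected absolute walk; \<open>5/32\<close> is \<open>1/4 * 5/8\<close>.\<close>

lemma expected_regret_ge:
  assumes T: "0 < T" and A: "learner_on (uniform_strategies M val) A"
  shows "5/32 * real h * sqrt (real T) \<le>
    expected_regret M K val fb A (replicate_pmf T (zero_or_one_bids K))"
proof -
  let ?p = "zero_or_one_bids K" and ?S = "\<lambda>\<beta>s. \<Sum>\<beta>\<leftarrow>\<beta>s. surplus \<beta>"
  let ?E = "measure_pmf.expectation (replicate_pmf T ?p)"
  let ?best = "\<lambda>\<beta>s. Max ((\<lambda>s. \<Sum>t<length \<beta>s. obtained_value K val s (\<beta>s ! t)) ` uniform_strategies M val)"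
  have fin: "finite (set_pmf ?p)" by (simp add: set_zero_or_one_bids)
  note finR = finite_set_replicate_pmf[OF fin, of T]
  note [simp] = integrable_measure_pmf_finite[OF finR]
  have mean: "measure_pmf.expectation ?p surplus = 0"
    using replicate_one_neq_zero by (simp add: expectation_zero_or_one_bids surplus_def)
  have "real T * real h + real h / 4 * ?E (\<lambda>\<beta>s. \<bar>?S \<beta>s\<bar>) =
      ?E (\<lambda>\<beta>s. real T * real h + real h / 4 * (?S \<beta>s + \<bar>?S \<beta>s\<bar>))"
    by (simp add: random_walk_mean[OF fin mean])
  also have "\<dots> \<le> ?E ?best"
    by (intro expectation_mono_finite[OF finR] best_strategy_ge)
  finally have "real T * real h + real h / 4 * ?E (\<lambda>\<beta>s. \<bar>?S \<beta>s\<bar>) \<le> ?E ?best" .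
  moreover have "?E (play_value (obtained_value K val) fb A []) \<le> real T * real h"
    by (rule expectation_play_value_le[OF _ A fin expected_obtained_value_le])
       (auto simp: uniform_strategies_def)
  moreover have "real h / 4 * (5/8 * sqrt (real T)) \<le> real h / 4 * ?E (\<lambda>\<beta>s. \<bar>?S \<beta>s\<bar>)"
    by (intro mult_left_mono expected_abs_surplus T) simp
  moreover have "expected_regret M K val fb A (replicate_pmf T ?p) =
      ?E ?best - ?E (play_value (obtained_value K val) fb A [])"
    unfolding expected_regret_def regret_def play_value_def[symmetric] by simp
  ultimately show ?thesis by simp
qed

end

lemma competing_law_zero_or_one_bids:
  "competing_law K T (replicate_pmf T (zero_or_one_bids K))"
  unfolding competing_law_def
  by (auto simp: set_replicate_pmf set_zero_or_one_bids lists_eq_set subset_iff)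

theorem mainTheorem6:
  "\<exists>c::real. c > 0 \<and>
     (\<forall>M K :: nat. 2 \<le> M \<and> M \<le> K \<longrightarrow>
       (\<exists>v :: nat \<Rightarrow> real. valuation M v \<and>
         (\<forall>T::nat. 1 \<le> T \<longrightarrow>
           (\<exists>D :: competing_bids list pmf. competing_law K T D \<and>
             (\<forall>A :: competing_bids learner. learner_on (uniform_strategies M v) A \<longrightarrow>
                expected_regret M K v full_information A D \<ge> c * real M * sqrt (real T)) \<and>
             (\<forall>A :: (nat \<times> real) learner. learner_on (uniform_strategies M v) A \<longrightarrow>
                expected_regret M K v (bandit K) A D \<ge> c * real M * sqrt (real T))))))"
proof (intro exI[of _ "5/96"] conjI allI impI)
  fix M K :: nat assume MK: "2 \<le> M \<and> M \<le> K"
  define h where "h = M div 2"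
  have h: "0 < h" "2 * h \<le> M" and "M \<le> 3 * h" "M \<le> K"
    using MK by (auto simp: h_def)
  show "\<exists>v. valuation M v \<and>
         (\<forall>T::nat. 1 \<le> T \<longrightarrow>
           (\<exists>D :: competing_bids list pmf. competing_law K T D \<and>
             (\<forall>A :: competing_bids learner. learner_on (uniform_strategies M v) A \<longrightarrow>
                expected_regret M K v full_information A D \<ge> 5/96 * real M * sqrt (real T)) \<and>
             (\<forall>A :: (nat \<times> real) learner. learner_on (uniform_strategies M v) A \<longrightarrow>
                expected_regret M K v (bandit K) A D \<ge> 5/96 * real M * sqrt (real T))))"
  proof (intro exI[of _ "step_valuation M h"] conjI allI impI)
    show "valuation M (step_valuation M h)"
      by (rule valuation_step[OF h \<open>M \<le> K\<close>])
    fix T :: nat assume "1 \<le> T"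
    \<comment> \<open>The factor 1/3 lost here is the worst ratio of \<open>M div 2\<close> to
      \<open>M\<close> for \<open>M \<ge> 2\<close>, attained at \<open>M = 3\<close>.\<close>
    have "5/96 * real M \<le> 5/32 * real h"
      using \<open>M \<le> 3 * h\<close> by linarith
    hence c: "5/96 * real M * sqrt (real T) \<le> 5/32 * real h * sqrt (real T)"
      by (rule mult_right_mono) simp
    \<comment> \<open>One law, chosen before the learner, serves both kinds of feedback, as the
      regret bound holds for every \<open>fb\<close>.\<close>
    show "\<exists>D :: competing_bids list pmf. competing_law K T D \<and>
             (\<forall>A :: competing_bids learner. learner_on (uniform_strategies M (step_valuation M h)) A \<longrightarrow>
                expected_regret M K (step_valuation M h) full_information A D \<ge> 5/96 * real M * sqrt (real T)) \<and>
             (\<forall>A :: (nat \<times> real) learner. learner_on (uniform_strategies M (step_valuation M h)) A \<longrightarrow>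
                expected_regret M K (step_valuation M h) (bandit K) A D \<ge> 5/96 * real M * sqrt (real T))"
      using \<open>1 \<le> T\<close>
      by (intro exI[of _ "replicate_pmf T (zero_or_one_bids K)"] conjI allI impI
          competing_law_zero_or_one_bids order_trans[OF c] expected_regret_ge[OF h \<open>M \<le> K\<close>]) auto
  qed
qed simp

end
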